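(* For any $k\in\mathbb{N}=\{0,1,2,\dots\}$ we have $M_kM_k^*=I_{2^k}$, where $M_k^*$ is the conjugate transpose of $M_k$ and $I_{2^k}$ is the $2^k\times2^k$ identity matrix.
   Context: For any positive integer $m$ and $k\ge0$, $\omega_{m,k}=\exp\left(\frac{(2m-1)\pi i}{2^k}\right)\in\mathbb{C}$. $M_k$ is the complex $2^k\times2^{k+1}$ matrix whose $j$-th row ($j=1,\dots,2^k$) is $$\tfrac12\,\epsilon_{j}+\tfrac{\omega_{j,k+1}}{2}\,\epsilon_{3j-1}+\tfrac12\,\epsilon_{2^k+j}-\tfrac{\omega_{j,k+1}}{2}\,\epsilon_{2^k+3j-1},$$ where $\epsilon_1,\dots,\epsilon_{2^{k+1}}$ are the standard unit row vectors of $\mathbb{C}^{2^{k+1}}$ and indices of $\epsilon$ are read modulo $2^{k+1}$ in $\{1,\dots,2^{k+1}\}$. *)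

theory Defs
  imports Complex_Main "Jordan_Normal_Form.Schur_Decomposition"
begin

definition omega :: "nat \<Rightarrow> nat \<Rightarrow> complex" where
  "omega m k = exp (of_real ((2 * real m - 1) * pi) * \<i> / 2 ^ k)"

(* The indices m >= 1 are 1-based and are read modulo 2^(k+1) in {1..2^(k+1)}; the library's
   unit_vec is 0-based, whence the shift by 1. *)
definition eps :: "nat \<Rightarrow> nat \<Rightarrow> complex vec" where
  "eps k m = unit_vec (2 ^ (k + 1)) ((m - 1) mod 2 ^ (k + 1))"

definition M_row :: "nat \<Rightarrow> nat \<Rightarrow> complex vec" where
  "M_row k j =
     (1 / 2) \<cdot>\<^sub>v eps k j + (omega j (k + 1) / 2) \<cdot>\<^sub>v eps k (3 * j - 1)
     + (1 / 2) \<cdot>\<^sub>v eps k (2 ^ k + j) - (omega j (k + 1) / 2) \<cdot>\<^sub>v eps k (2 ^ k + 3 * j - 1)"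

definition M :: "nat \<Rightarrow> complex mat" where
  "M k = mat_of_rows (2 ^ (k + 1)) (map (M_row k) [1..<2 ^ k + 1])"

lemma M_carrier: "M k \<in> carrier_mat (2 ^ k) (2 ^ (k + 1))"
  unfolding M_def carrier_mat_def by (simp del: upt_Suc)

lemma row_M:
  assumes "1 \<le> j" "j \<le> 2 ^ k"
  shows "row (M k) (j - 1) = M_row k j"
proof -
  have "j - 1 < length (map (M_row k) [1..<2 ^ k + 1])"
    using assms by (simp del: upt_Suc)
  moreover have "map (M_row k) [1..<2 ^ k + 1] ! (j - 1) = M_row k j"
    using assms by (subst nth_map) (simp_all del: upt_Suc)
  moreover have "M_row k j \<in> carrier_vec (2 ^ (k + 1))"
    unfolding M_row_def eps_def by simp
  ultimately show ?thesis
    unfolding M_def using mat_of_rows_row by metis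
qed

end

theory Submission
  imports Defs "HOL-Number_Theory.Cong"
begin

text \<open>
  Put \<open>N = 2 ^ k\<close> and count rows and columns from 0. Row \<open>i\<close> of the matrix is \<open>u\<^sub>i + v\<^sub>i\<close>, where
  \<open>u\<^sub>i\<close> has the entry \<open>1/2\<close> in the columns \<open>i\<close> and \<open>i + N\<close>, and \<open>v\<^sub>i\<close> has the opposite entries
  \<open>\<plusminus>\<omega>/2\<close> in the two columns congruent to \<open>3 * i + 1\<close> modulo \<open>N\<close>. The left and right halves of a
  row are thus of the form \<open>a + b\<close> and \<open>a - b\<close> (\<open>M_entry_left\<close>, \<open>M_entry_right\<close>), and in the inner
  product of two rows the mixed terms cancel:
  \<open>(a + b) * cnj (a' + b') + (a - b) * cnj (a' - b') = 2 * (a * cnj a' + b * cnj b')\<close>.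
  This covers the case that the columns of \<open>u\<^sub>i\<close> and \<open>v\<^sub>l\<close> coincide.

  The halves \<open>a\<close> of distinct rows have disjoint supports, and so do the halves \<open>b\<close>, since
  \<open>3 * i + 1\<close> determines \<open>i < N\<close> modulo \<open>N\<close>, as 3 is coprime to \<open>2 ^ k\<close>. So distinct rows are orthogonal.
  On the diagonal \<open>a\<close> and \<open>b\<close> contribute \<open>1/2\<close> each, because \<open>\<omega>\<close> has modulus 1.
\<close>

lemma omega_mult_cnj: "omega m k * cnj (omega m k) = 1"
proof -
  have "omega m k = cis ((2 * real m - 1) * pi / 2 ^ k)"
    unfolding omega_def cis_conv_exp by (simp add: mult_ac)
  then show ?thesis by (simp add: cis_cnj cis_mult)
qed

lemma inj_on_affine_mod_power2: "inj_on (\<lambda>i. (3 * i + 1) mod 2 ^ k) {..<(2::nat) ^ k}"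
proof (rule inj_onI)
  fix i l :: nat
  assume i: "i \<in> {..<2 ^ k}" and l: "l \<in> {..<2 ^ k}"
    and "(3 * i + 1) mod 2 ^ k = (3 * l + 1) mod 2 ^ k"
  then have "[3 * i + 1 = 3 * l + 1] (mod 2 ^ k)" by (simp only: cong_def)
  then have "[3 * i = 3 * l] (mod 2 ^ k)" by (simp only: cong_add_rcancel_nat)
  moreover have "coprime (3::nat) (2 ^ k)" by simp
  ultimately have "[i = l] (mod 2 ^ k)" using cong_mult_lcancel_nat by blast
  then show "i = l" using i l by (simp add: cong_def)
qed

text \<open>Whether a residue modulo \<open>2 * N\<close> lies in the left or the right half is the parity of the
  quotient by \<open>N\<close>.\<close>

lemma eq_mod_double_iff:
  fixes c q N :: nat
  assumes "c < N"
  shows "c = q mod (2 * N) \<longleftrightarrow> c = q mod N \<and> even (q div N)"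
    and "c + N = q mod (2 * N) \<longleftrightarrow> c = q mod N \<and> odd (q div N)"
proof -
  have r: "q mod N < N" using assms by simp
  have "q mod (2 * N) = N * (q div N mod 2) + q mod N"
    using mod_mult2_eq[of q N 2] by (simp add: mult.commute)
  then have q: "q mod (2 * N) = (if even (q div N) then q mod N else N + q mod N)"
    by (simp only: mod2_eq_if) simp
  have halves: "c = (if e then s else N + s) \<longleftrightarrow> c = s \<and> e"
    "c + N = (if e then s else N + s) \<longleftrightarrow> c = s \<and> \<not> e" if "s < N" for e s
    using that assms by auto
  show "c = q mod (2 * N) \<longleftrightarrow> c = q mod N \<and> even (q div N)"
    unfolding q by (rule halves(1)[OF r])
  show "c + N = q mod (2 * N) \<longleftrightarrow> c = q mod N \<and> odd (q div N)"
    unfolding q by (rule halves(2)[OF r])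
qed

lemma M_entry:
  assumes "i < 2 ^ k" "c < 2 * 2 ^ k"
  shows "M k $$ (i, c) =
    ((if c = i then 1 else 0) + (if c = 2 ^ k + i then 1 else 0)) / 2
    + omega (i + 1) (k + 1) / 2 *
      ((if c = (3 * i + 1) mod (2 * 2 ^ k) then 1 else 0)
       - (if c = (2 ^ k + (3 * i + 1)) mod (2 * 2 ^ k) then 1 else 0))"
proof -
  have "M k $$ (i, c) = row (M k) i $ c"
    using M_carrier[of k] assms by simp
  also have "row (M k) i = M_row k (i + 1)"
    using row_M[of "i + 1" k] assms by simp
  finally show ?thesis
    using assms by (simp add: M_row_def eps_def unit_vec_def algebra_simps)
qed

text \<open>Twice the nonzero entry of the antisymmetric part of row \<open>i\<close> in the left half of the columns. The
  sign records in which half the index \<open>3 * i + 1\<close> itself falls.\<close>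

definition signed_omega :: "nat \<Rightarrow> nat \<Rightarrow> complex" where
  "signed_omega k i = (- 1) ^ ((3 * i + 1) div 2 ^ k) * omega (i + 1) (k + 1)"

lemma signed_omega_mult_cnj: "signed_omega k i * cnj (signed_omega k i) = 1"
proof -
  have "signed_omega k i * cnj (signed_omega k i)
      = ((- 1) ^ ((3 * i + 1) div 2 ^ k) * (- 1) ^ ((3 * i + 1) div 2 ^ k))
        * (omega (i + 1) (k + 1) * cnj (omega (i + 1) (k + 1)))"
    by (simp add: signed_omega_def)
  then show ?thesis by (simp only: omega_mult_cnj minus_one_mult_self mult_1)
qed

lemma
  assumes "i < 2 ^ k" "c < 2 ^ k"
  shows M_entry_left: "M k $$ (i, c) =
      (if c = i then 1 else 0) / 2
      + (if c = (3 * i + 1) mod 2 ^ k then signed_omega k i else 0) / 2"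
    and M_entry_right: "M k $$ (i, c + 2 ^ k) =
      (if c = i then 1 else 0) / 2
      - (if c = (3 * i + 1) mod 2 ^ k then signed_omega k i else 0) / 2"
proof -
  define q where "q = 3 * i + 1"
  have shift: "(2 ^ k + q) mod 2 ^ k = q mod 2 ^ k" "(2 ^ k + q) div 2 ^ k = q div 2 ^ k + 1"
    by simp_all
  note half = eq_mod_double_iff[OF assms(2)]
  show "M k $$ (i, c) = (if c = i then 1 else 0) / 2
      + (if c = (3 * i + 1) mod 2 ^ k then signed_omega k i else 0) / 2"
    using assms M_entry[of i k c]
    unfolding signed_omega_def q_def[symmetric] half shift by auto
  show "M k $$ (i, c + 2 ^ k) = (if c = i then 1 else 0) / 2
      - (if c = (3 * i + 1) mod 2 ^ k then signed_omega k i else 0) / 2"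
    using assms M_entry[of i k "c + 2 ^ k"]
    unfolding signed_omega_def q_def[symmetric] half shift by auto
qed

lemma index_mult_mat_adjoint:
  fixes A :: "complex mat"
  assumes "A \<in> carrier_mat m n" "i < m" "l < m"
  shows "(A * mat_adjoint A) $$ (i, l) = (\<Sum>c<n. A $$ (i, c) * cnj (A $$ (l, c)))"
  using assms
  by (auto simp: mat_adjoint_def scalar_prod_def mat_of_rows_def atLeast0LessThan intro!: sum.cong)

lemma sum_lessThan_double:
  fixes f :: "nat \<Rightarrow> 'a::comm_monoid_add"
  shows "(\<Sum>c<2 * n. f c) = (\<Sum>c<n. f c + f (c + n))"
proof -
  have "(\<Sum>c<2 * n. f c) = (\<Sum>c<n. f c) + (\<Sum>c=n..<n + n. f c)"
    by (simp add: lessThan_atLeast0 sum.atLeastLessThan_concat mult_2)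
  also have "(\<Sum>c=n..<n + n. f c) = (\<Sum>c<n. f (c + n))"
    using sum.shift_bounds_nat_ivl[of f 0 n n] by (simp add: lessThan_atLeast0)
  finally show ?thesis by (simp add: sum.distrib)
qed

text \<open>The mixed terms of the left and the right half cancel; what remains are the inner products of
  two multiples of unit vectors.\<close>

lemma inner_product_rows_M:
  assumes i: "i < 2 ^ k" and l: "l < 2 ^ k"
  shows "(\<Sum>c<2 * 2 ^ k. M k $$ (i, c) * cnj (M k $$ (l, c))) = (if i = l then 1 else 0)"
proof -
  define a :: "nat \<Rightarrow> nat \<Rightarrow> complex" where
    "a i c = (if c = i then 1 else 0)" for i c
  define b :: "nat \<Rightarrow> nat \<Rightarrow> complex" where
    "b i c = (if c = (3 * i + 1) mod 2 ^ k then signed_omega k i else 0)" for i c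
  have "(\<Sum>c<2 * 2 ^ k. M k $$ (i, c) * cnj (M k $$ (l, c)))
      = (\<Sum>c<2 ^ k. M k $$ (i, c) * cnj (M k $$ (l, c))
          + M k $$ (i, c + 2 ^ k) * cnj (M k $$ (l, c + 2 ^ k)))"
    by (rule sum_lessThan_double)
  also have "\<dots> = (\<Sum>c<2 ^ k. (a i c * cnj (a l c) + b i c * cnj (b l c)) / 2)"
  proof (rule sum.cong[OF refl])
    fix c :: nat
    assume "c \<in> {..<2 ^ k}"
    then have c: "c < 2 ^ k" by simp
    have entries: "M k $$ (j, c) = a j c / 2 + b j c / 2"
        "M k $$ (j, c + 2 ^ k) = a j c / 2 - b j c / 2" if "j < 2 ^ k" for j
      using M_entry_left[OF that c] M_entry_right[OF that c] by (simp_all add: a_def b_def)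
    show "M k $$ (i, c) * cnj (M k $$ (l, c)) + M k $$ (i, c + 2 ^ k) * cnj (M k $$ (l, c + 2 ^ k))
        = (a i c * cnj (a l c) + b i c * cnj (b l c)) / 2"
      unfolding entries[OF i] entries[OF l] by (simp add: field_simps)
  qed
  also have "\<dots> = ((\<Sum>c<2 ^ k. a i c * cnj (a l c)) + (\<Sum>c<2 ^ k. b i c * cnj (b l c))) / 2"
    by (simp add: sum_divide_distrib[symmetric] sum.distrib)
  also have "(\<Sum>c<2 ^ k. a i c * cnj (a l c)) = (if i = l then 1 else 0)"
  proof -
    have "(\<Sum>c<2 ^ k. a i c * cnj (a l c)) = (\<Sum>c<2 ^ k. if c = i then cnj (a l i) else 0)"
      by (rule sum.cong) (auto simp: a_def)
    then show ?thesis using i by (simp add: a_def)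
  qed
  also have "(\<Sum>c<2 ^ k. b i c * cnj (b l c)) = (if i = l then 1 else 0)"
  proof -
    define r where "r = (3 * i + 1) mod 2 ^ k"
    have "(\<Sum>c<2 ^ k. b i c * cnj (b l c))
        = (\<Sum>c<2 ^ k. if c = r then signed_omega k i * cnj (b l r) else 0)"
      by (rule sum.cong) (auto simp: b_def r_def)
    also have "\<dots> = signed_omega k i * cnj (b l r)"
      by (simp add: r_def)
    also have "r = (3 * l + 1) mod 2 ^ k \<longleftrightarrow> i = l"
      unfolding r_def using inj_on_eq_iff[OF inj_on_affine_mod_power2[of k], of i l] i l by simp
    then have "signed_omega k i * cnj (b l r) = (if i = l then 1 else 0)"
      by (simp add: b_def signed_omega_mult_cnj)
    finally show ?thesis .
  qed
  finally show ?thesis by simp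
qed

theorem theorem8p8:
  fixes k :: nat
  shows "M k * mat_adjoint (M k) = (1\<^sub>m (2 ^ k) :: complex mat)"
proof (rule eq_matI)
  show "dim_row (M k * mat_adjoint (M k)) = dim_row (1\<^sub>m (2 ^ k) :: complex mat)"
    using M_carrier[of k] by simp
  show "dim_col (M k * mat_adjoint (M k)) = dim_col (1\<^sub>m (2 ^ k) :: complex mat)"
    using M_carrier[of k] by (simp add: mat_adjoint_def)
next
  fix i l
  assume "i < dim_row (1\<^sub>m (2 ^ k) :: complex mat)" "l < dim_col (1\<^sub>m (2 ^ k) :: complex mat)"
  then have il: "i < 2 ^ k" "l < 2 ^ k" by simp_all
  then show "(M k * mat_adjoint (M k)) $$ (i, l) = (1\<^sub>m (2 ^ k) :: complex mat) $$ (i, l)"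
    using index_mult_mat_adjoint[OF M_carrier il] inner_product_rows_M[OF il] by simp
qed

end
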